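(* Let $k>0$ be an integer. If $(x,y)$ is a seed of the equation $$y^2=8x^2+8(1-k)x+(2k-1)^2,$$ then $(k-1-x,y)$ is also a seed. Furthermore, the corresponding classes of solutions are conjugate.
   Context: A seed (for $k>0$) is a pair of integers $(x,y)$ satisfying $y^2=8x^2+8(1-k)x+(2k-1)^2$ with $0\le x<k$ and $y>0$. The class of solutions corresponding to a seed $(x,y)$ is the sequence $((x_i,y_i))_{i\in\mathbb Z}$ with $(x_{-1},y_{-1})=(x,y)$ and $x_{i+1}=3x_i+y_i+1-k$, $y_{i+1}=8x_i+3y_i+4-4k$ for all $i\in\mathbb Z$ (the map is invertible, with inverse $(x,y)\mapsto(3x-y+1-k,-8x+3y+4k-4)$). Conjugacy: under the substitution $z=2x+1-k$ the equation becomes the Pell-type equation $y^2-2z^2=2k^2-1$. As usual (Nagell), two integer solutions $(y,z),(y',z')$ of $y^2-2z^2=N$ belong to the same class if $y'+z'\sqrt2=(y+z\sqrt2)(u+v\sqrt2)$ for some integers $u,v$ with $u^2-2v^2=1$; the conjugate of a class $K$ is the class $\{(y,-z):(y,z)\in K\}$. Two classes of solutions of the original equation are conjugate if the classes of $y^2-2z^2=2k^2-1$ containing the corresponding solutions $(y,z)=(y_i,2x_i+1-k)$ are conjugate. *)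

theory Defs
  imports Complex_Main
begin

definition seed :: "int \<Rightarrow> int \<times> int \<Rightarrow> bool" where
  "seed k = (\<lambda>(x, y). y\<^sup>2 = 8 * x\<^sup>2 + 8 * (1 - k) * x + (2 * k - 1)\<^sup>2 \<and> 0 \<le> x \<and> x < k \<and> y > 0)"

definition next_sol :: "int \<Rightarrow> int \<times> int \<Rightarrow> int \<times> int" where
  "next_sol k = (\<lambda>(x, y). (3 * x + y + 1 - k, 8 * x + 3 * y + 4 - 4 * k))"

definition prev_sol :: "int \<Rightarrow> int \<times> int \<Rightarrow> int \<times> int" where
  "prev_sol k = (\<lambda>(x, y). (3 * x - y + 1 - k, - 8 * x + 3 * y + 4 * k - 4))"

text \<open>The bi-infinite sequence generated by \<open>p\<close>, which sits at index \<open>-1\<close>; it is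
  characterised by \<open>sol_class_minus_one\<close>, \<open>sol_class_rec\<close> and \<open>sol_class_unique\<close> below.\<close>

definition sol_class :: "int \<Rightarrow> int \<times> int \<Rightarrow> int \<Rightarrow> int \<times> int" where
  "sol_class k p i =
     (if i \<ge> -1 then (next_sol k ^^ nat (i + 1)) p else (prev_sol k ^^ nat (- 1 - i)) p)"

lemma next_prev_sol [simp]: "next_sol k (prev_sol k p) = p"
  by (cases p) (simp add: next_sol_def prev_sol_def)

lemma prev_next_sol [simp]: "prev_sol k (next_sol k p) = p"
  by (cases p) (simp add: next_sol_def prev_sol_def)

lemma sol_class_minus_one: "sol_class k p (-1) = p"
  by (simp add: sol_class_def)

lemma sol_class_rec: "sol_class k p (i + 1) = next_sol k (sol_class k p i)"
proof (cases "i \<ge> -1")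
  case True
  then have "nat (i + 1 + 1) = Suc (nat (i + 1))" by simp
  with True show ?thesis by (simp add: sol_class_def)
next
  case False
  then have "nat (- 1 - i) = Suc (nat (- 1 - (i + 1)))" by simp
  with False show ?thesis by (cases "i = -2") (simp_all add: sol_class_def)
qed

lemma sol_class_unique:
  assumes "s (-1) = p" and "\<And>i. s (i + 1) = next_sol k (s i)"
  shows "s = sol_class k p"
proof
  fix i :: int
  show "s i = sol_class k p i"
  proof (induction i rule: int_induct[where k = "-1"])
    case base
    show ?case by (simp add: assms(1) sol_class_minus_one)
  next
    case (step1 i)
    then show ?case by (simp add: assms(2) sol_class_rec)
  next
    case (step2 i)
    then show ?case
      by (metis assms(2) sol_class_rec prev_next_sol diff_add_cancel)
  qed
qed

definition pell_sols :: "int \<Rightarrow> (int \<times> int) set" where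
  "pell_sols N = {(y, z). y\<^sup>2 - 2 * z\<^sup>2 = N}"

definition pell_rel :: "int \<Rightarrow> ((int \<times> int) \<times> (int \<times> int)) set" where
  "pell_rel N = {((y, z), (y', z')).
     (y, z) \<in> pell_sols N \<and> (y', z') \<in> pell_sols N \<and>
     (\<exists>u v :: int. u\<^sup>2 - 2 * v\<^sup>2 = 1 \<and>
        real_of_int y' + real_of_int z' * sqrt 2 =
          (real_of_int y + real_of_int z * sqrt 2) * (real_of_int u + real_of_int v * sqrt 2))}"

lemma equiv_pell_rel: "equiv (pell_sols N) (pell_rel N)"
proof (rule equivI)
  show "pell_rel N \<subseteq> pell_sols N \<times> pell_sols N"
    by (auto simp: pell_rel_def)
  show "refl_on (pell_sols N) (pell_rel N)"
  proof (rule refl_onI, clarify)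
    fix y z assume "(y, z) \<in> pell_sols N"
    moreover have "(1::int)\<^sup>2 - 2 * 0\<^sup>2 = 1 \<and> real_of_int y + real_of_int z * sqrt 2 =
        (real_of_int y + real_of_int z * sqrt 2) * (real_of_int 1 + real_of_int 0 * sqrt 2)"
      by simp
    ultimately show "((y, z), (y, z)) \<in> pell_rel N"
      unfolding pell_rel_def by blast
  qed
  show "sym (pell_rel N)"
  proof (rule symI, clarify)
    fix y z y' z' assume "((y, z), (y', z')) \<in> pell_rel N"
    then obtain u v where *: "(y, z) \<in> pell_sols N" "(y', z') \<in> pell_sols N" "u\<^sup>2 - 2 * v\<^sup>2 = 1"
      "real_of_int y' + real_of_int z' * sqrt 2 =
         (real_of_int y + real_of_int z * sqrt 2) * (real_of_int u + real_of_int v * sqrt 2)"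
      by (auto simp: pell_rel_def)
    have "real_of_int (u\<^sup>2 - 2 * v\<^sup>2) = 1" using *(3) by simp
    then have "(real_of_int u + real_of_int v * sqrt 2) * (real_of_int u + real_of_int (- v) * sqrt 2) = 1"
      by (simp add: algebra_simps power2_eq_square)
    then have "real_of_int y + real_of_int z * sqrt 2 =
        (real_of_int y' + real_of_int z' * sqrt 2) * (real_of_int u + real_of_int (- v) * sqrt 2)"
      unfolding *(4) by (metis mult.assoc mult.right_neutral)
    moreover have "u\<^sup>2 - 2 * (- v)\<^sup>2 = 1" using *(3) by simp
    ultimately show "((y', z'), (y, z)) \<in> pell_rel N"
      using *(1,2) unfolding pell_rel_def by blast
  qed
  show "trans (pell_rel N)"
  proof (rule transI, clarify)
    fix y z y' z' y'' z''
    assume "((y, z), (y', z')) \<in> pell_rel N" "((y', z'), (y'', z'')) \<in> pell_rel N"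
    then obtain u v u' v' where *: "(y, z) \<in> pell_sols N" "(y'', z'') \<in> pell_sols N"
      "u\<^sup>2 - 2 * v\<^sup>2 = 1" "u'\<^sup>2 - 2 * v'\<^sup>2 = 1"
      "real_of_int y' + real_of_int z' * sqrt 2 =
         (real_of_int y + real_of_int z * sqrt 2) * (real_of_int u + real_of_int v * sqrt 2)"
      "real_of_int y'' + real_of_int z'' * sqrt 2 =
         (real_of_int y' + real_of_int z' * sqrt 2) * (real_of_int u' + real_of_int v' * sqrt 2)"
      by (auto simp: pell_rel_def)
    have "(u * u' + 2 * v * v')\<^sup>2 - 2 * (u * v' + v * u')\<^sup>2 = (u\<^sup>2 - 2 * v\<^sup>2) * (u'\<^sup>2 - 2 * v'\<^sup>2)"
      by (simp add: algebra_simps power2_eq_square)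
    then have "(u * u' + 2 * v * v')\<^sup>2 - 2 * (u * v' + v * u')\<^sup>2 = 1"
      using *(3,4) by simp
    moreover have "real_of_int y'' + real_of_int z'' * sqrt 2 =
        (real_of_int y + real_of_int z * sqrt 2) *
        (real_of_int (u * u' + 2 * v * v') + real_of_int (u * v' + v * u') * sqrt 2)"
      unfolding *(5,6) by (simp add: algebra_simps)
    ultimately show "((y, z), (y'', z'')) \<in> pell_rel N"
      using *(1,2) unfolding pell_rel_def by blast
  qed
qed

definition pell_classes :: "int \<Rightarrow> (int \<times> int) set set" where
  "pell_classes N = pell_sols N // pell_rel N"

definition conjugate_class :: "(int \<times> int) set \<Rightarrow> (int \<times> int) set" where
  "conjugate_class K = {(y, - z) | y z. (y, z) \<in> K}"

text \<open>The substitution \<open>z = 2 * x + 1 - k\<close>, which turns the equation into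
  \<open>y\<^sup>2 - 2 * z\<^sup>2 = 2 * k\<^sup>2 - 1\<close>; the components are swapped, to \<open>(y, z)\<close>.\<close>

definition to_pell :: "int \<Rightarrow> int \<times> int \<Rightarrow> int \<times> int" where
  "to_pell k = (\<lambda>(x, y). (y, 2 * x + 1 - k))"

definition conjugate_sol_classes ::
    "int \<Rightarrow> (int \<Rightarrow> int \<times> int) \<Rightarrow> (int \<Rightarrow> int \<times> int) \<Rightarrow> bool" where
  "conjugate_sol_classes k s t \<longleftrightarrow>
     (\<exists>K \<in> pell_classes (2 * k\<^sup>2 - 1). \<exists>L \<in> pell_classes (2 * k\<^sup>2 - 1).
        (\<forall>i. to_pell k (s i) \<in> K) \<and> (\<forall>i. to_pell k (t i) \<in> L) \<and> L = conjugate_class K)"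

end

theory Submission
  imports Defs "HOL-Computational_Algebra.Polynomial"
begin

text \<open>Under the substitution \<open>z = 2 * x + 1 - k\<close> the equation reads
  \<open>y\<^sup>2 - 2 * z\<^sup>2 = 2 * k\<^sup>2 - 1\<close>, and the reflection \<open>x \<mapsto> k - 1 - x\<close> becomes \<open>z \<mapsto> - z\<close>. So the
  equation is symmetric under the reflection, which also preserves the interval \<open>0 \<le> x < k\<close>:
  seeds go to seeds.

  In the same coordinates the recurrence is multiplication of \<open>y + z\<surd>2\<close> by the unit \<open>3 + 2\<surd>2\<close>,
  which has norm \<open>1\<close>; hence a whole bi-infinite sequence stays inside one Pell class
  (\<open>sol_class_in_pell_class\<close>). Conjugation \<open>\<surd>2 \<mapsto> - \<surd>2\<close> is multiplicative and preserves norms, so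
  it carries the class of an element onto the class of its conjugate (\<open>conjugate_class_Image\<close>).
  Since the two seeds are conjugate elements, their classes are conjugate classes.\<close>

text \<open>\<open>\<surd>2\<close> is an algebraic integer, so if it were rational it would be an integer strictly
  between \<open>1\<close> and \<open>2\<close>.\<close>

lemma sqrt_2_irrational: "sqrt 2 \<notin> \<rat>"
proof
  assume "sqrt 2 \<in> \<rat>"
  then have "sqrt 2 \<in> \<int>"
    by (intro rational_algebraic_int_is_int algebraic_int_sqrt algebraic_int_numeral)
  then obtain n :: int where n: "sqrt 2 = real_of_int n"
    by (elim Ints_cases)
  have "1 < sqrt 2" "sqrt 2 < 2"
    by (simp_all add: real_less_lsqrt)
  with n show False by simp
qed

lemma int_add_sqrt2_eq_iff:
  fixes a b c d :: int
  shows "real_of_int a + real_of_int b * sqrt 2 = real_of_int c + real_of_int d * sqrt 2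
    \<longleftrightarrow> a = c \<and> b = d"
proof
  assume eq: "real_of_int a + real_of_int b * sqrt 2 = real_of_int c + real_of_int d * sqrt 2"
  have "b = d"
  proof (rule ccontr)
    assume "b \<noteq> d"
    then have "sqrt 2 = real_of_int (c - a) / real_of_int (b - d)"
      using eq by (simp add: field_simps)
    then have "sqrt 2 \<in> \<rat>"
      by (metis Rats_divide Rats_of_int)
    then show False
      using sqrt_2_irrational by simp
  qed
  with eq show "a = c \<and> b = d" by simp
qed simp

text \<open>Comparing coefficients turns the real equation in the Pell relation into two integer
  equations; on these, conjugation acts by changing the signs of \<open>z\<close>, \<open>z'\<close> and \<open>v\<close>.\<close>

lemma pell_rel_iff:
  "((y, z), (y', z')) \<in> pell_rel N \<longleftrightarrow>
     (y, z) \<in> pell_sols N \<and> (y', z') \<in> pell_sols N \<and>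
     (\<exists>u v. u\<^sup>2 - 2 * v\<^sup>2 = 1 \<and> y' = y * u + 2 * z * v \<and> z' = y * v + z * u)"
proof -
  have "(real_of_int y + real_of_int z * sqrt 2) * (real_of_int u + real_of_int v * sqrt 2) =
      real_of_int (y * u + 2 * z * v) + real_of_int (y * v + z * u) * sqrt 2" for u v :: int
    by (simp add: algebra_simps)
  then show ?thesis
    unfolding pell_rel_def by (simp only: int_add_sqrt2_eq_iff mem_Collect_eq case_prod_conv)
qed

text \<open>If \<open>u + v\<surd>2\<close> carries one element to the other, then its conjugate \<open>u - v\<surd>2\<close>, which has the
  same norm, carries one conjugate to the other.\<close>

lemma pell_rel_conjugate:
  assumes "((y, z), (y', z')) \<in> pell_rel N"
  shows "((y, - z), (y', - z')) \<in> pell_rel N"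
proof -
  obtain u v where "(y, z) \<in> pell_sols N" "(y', z') \<in> pell_sols N" "u\<^sup>2 - 2 * v\<^sup>2 = 1"
    and "y' = y * u + 2 * z * v" "z' = y * v + z * u"
    using assms unfolding pell_rel_iff by blast
  moreover from this have "u\<^sup>2 - 2 * (- v)\<^sup>2 = 1 \<and> y' = y * u + 2 * (- z) * (- v)
      \<and> - z' = y * (- v) + (- z) * u"
    by simp
  moreover have "(a, - b) \<in> pell_sols N \<longleftrightarrow> (a, b) \<in> pell_sols N" for a b
    by (simp add: pell_sols_def)
  ultimately show ?thesis
    unfolding pell_rel_iff by blast
qed

text \<open>Conjugation respects the relation and is an involution, so it maps a class onto, not just
  into, the class of the conjugate element.\<close>

lemma conjugate_class_Image:
  "conjugate_class (pell_rel N `` {(y, z)}) = pell_rel N `` {(y, - z)}"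
proof (intro equalityI subsetI)
  fix q assume "q \<in> conjugate_class (pell_rel N `` {(y, z)})"
  then show "q \<in> pell_rel N `` {(y, - z)}"
    by (auto simp: conjugate_class_def dest: pell_rel_conjugate)
next
  fix q assume q: "q \<in> pell_rel N `` {(y, - z)}"
  obtain a b where ab: "q = (a, b)" by (cases q)
  with q have "((y, z), (a, - b)) \<in> pell_rel N"
    using pell_rel_conjugate[of y "- z" a b N] by simp
  with ab show "q \<in> conjugate_class (pell_rel N `` {(y, z)})"
    unfolding conjugate_class_def by force
qed

lemma to_pell_in_pell_sols_iff:
  "to_pell k (x, y) \<in> pell_sols (2 * k\<^sup>2 - 1) \<longleftrightarrow>
     y\<^sup>2 = 8 * x\<^sup>2 + 8 * (1 - k) * x + (2 * k - 1)\<^sup>2"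
  by (auto simp: to_pell_def pell_sols_def algebra_simps power2_eq_square)

lemma pell_rel_next_sol:
  assumes "to_pell k p \<in> pell_sols N"
  shows "(to_pell k p, to_pell k (next_sol k p)) \<in> pell_rel N"
proof -
  obtain x y where p: "p = (x, y)" by (cases p)
  define z where "z = 2 * x + 1 - k"
  have 1: "to_pell k p = (y, z)"
    by (simp add: p to_pell_def z_def)
  \<comment> \<open>\<open>(y + z\<surd>2) (3 + 2\<surd>2) = (3y + 4z) + (2y + 3z)\<surd>2\<close>, and \<open>3 + 2\<surd>2\<close> has norm \<open>9 - 8 = 1\<close>.\<close>
  have 2: "to_pell k (next_sol k p) = (y * 3 + 2 * z * 2, y * 2 + z * 3)"
    by (simp add: p to_pell_def next_sol_def z_def)
  have "(y * 3 + 2 * z * 2, y * 2 + z * 3) \<in> pell_sols N"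
    using assms by (simp add: 1 pell_sols_def algebra_simps power2_eq_square)
  moreover have "(3::int)\<^sup>2 - 2 * 2\<^sup>2 = 1" by simp
  ultimately show ?thesis
    using assms unfolding 1 2 pell_rel_iff by blast
qed

lemma to_pell_prev_sol:
  assumes "to_pell k p \<in> pell_sols N"
  shows "to_pell k (prev_sol k p) \<in> pell_sols N"
  using assms
  by (cases p) (simp add: to_pell_def prev_sol_def pell_sols_def algebra_simps power2_eq_square)

text \<open>Every step of the recurrence, forwards or backwards, relates consecutive terms; symmetry and
  transitivity of the Pell relation then link any term to the initial one.\<close>

lemma sol_class_in_pell_class:
  assumes "to_pell k p \<in> pell_sols N"
  shows "to_pell k (sol_class k p i) \<in> pell_rel N `` {to_pell k p}"
proof -
  note E = equiv_pell_rel[of N]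
  have "(to_pell k p, to_pell k (sol_class k p i)) \<in> pell_rel N"
  proof (induction i rule: int_induct[where k = "-1"])
    case base
    show ?case
      using E assms by (simp add: sol_class_minus_one equiv_def refl_on_def)
  next
    case (step1 i)
    then have "to_pell k (sol_class k p i) \<in> pell_sols N"
      using E by (auto simp: equiv_def)
    with step1 show ?case
      by (metis E equiv_def pell_rel_next_sol sol_class_rec transE)
  next
    case (step2 i)
    have prev: "sol_class k p (i - 1) = prev_sol k (sol_class k p i)"
      by (metis diff_add_cancel prev_next_sol sol_class_rec)
    from step2 have "to_pell k (sol_class k p i) \<in> pell_sols N"
      using E by (auto simp: equiv_def)
    then have "(to_pell k (sol_class k p (i - 1)), to_pell k (sol_class k p i)) \<in> pell_rel N"
      unfolding prev by (metis next_prev_sol pell_rel_next_sol to_pell_prev_sol)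
    with step2 show ?case
      by (metis E equiv_def symE transE)
  qed
  then show ?thesis by simp
qed

lemma seed_reflect:
  assumes "seed k (x, y)"
  shows "seed k (k - 1 - x, y)"
  using assms by (auto simp: seed_def algebra_simps power2_eq_square)

theorem theorem4p6:
  fixes k x y :: int
  assumes "k > 0" and "seed k (x, y)"
  shows "seed k (k - 1 - x, y) \<and>
    conjugate_sol_classes k (sol_class k (x, y)) (sol_class k (k - 1 - x, y))"
proof
  show reflected: "seed k (k - 1 - x, y)"
    using assms(2) by (rule seed_reflect)
  let ?N = "2 * k\<^sup>2 - 1"
  let ?K = "pell_rel ?N `` {to_pell k (x, y)}"
  let ?L = "pell_rel ?N `` {to_pell k (k - 1 - x, y)}"
  have sols: "to_pell k (x, y) \<in> pell_sols ?N" "to_pell k (k - 1 - x, y) \<in> pell_sols ?N"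
    using assms(2) reflected unfolding to_pell_in_pell_sols_iff by (simp_all add: seed_def)
  have "?K \<in> pell_classes ?N" "?L \<in> pell_classes ?N"
    unfolding pell_classes_def using sols by (auto intro: quotientI)
  moreover have "?L = conjugate_class ?K"
    by (simp add: to_pell_def conjugate_class_Image algebra_simps)
  ultimately show "conjugate_sol_classes k (sol_class k (x, y)) (sol_class k (k - 1 - x, y))"
    unfolding conjugate_sol_classes_def
    using sol_class_in_pell_class[OF sols(1)] sol_class_in_pell_class[OF sols(2)] by blast
qed

end
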